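(* Let $S_1, S_2 \in K[X,Y]$ be homogeneous polynomials of degree one with $\gcd(S_1,S_2)=1$, and let $L\in K[D_x,D_y]$ be an operator of order three. Then the following are equivalent: (i) $L$ has a first-order left factor with symbol $S_1$ and a first-order right factor with symbol $S_2$; (ii) $L$ has a factorization of the type $(S_1)(T)(S_2)$, where $T=\mathrm{Sym}(L)/(S_1S_2)$.
   Context: $K$ is a field of characteristic zero with commuting derivations $\partial_x,\partial_y$, assumed differentially closed (it contains solutions of the, possibly non-linear, differential equations with coefficients in $K$ that are needed). $K[D_x,D_y]$ is the ring of (bivariate) linear partial differential operators over $K$: $D_x,D_y$ commute with each other, and $D_i a = aD_i+\partial_i(a)$ for $a\in K$, $i \in \{x,y\}$. Multiplication (composition) is denoted $\circ$. For $L=\sum_{i+j\le d}a_{ij}D_x^iD_y^j$ of order $d$, its (principal) symbol is $\mathrm{Sym}(L)=\sum_{i+j=d}a_{ij}X^iY^j\in K[X,Y]$, with $X,Y$ commuting formal variables; one has $\mathrm{Sym}(L_1\circ L_2)=\mathrm{Sym}(L_1)\mathrm{Sym}(L_2)$. An operator $F$ is a left (respectively right) factor of $L$ if $L=F\circ G$ (respectively $L=G\circ F$) for some $G\in K[D_x,D_y]$. If $\mathrm{Sym}(L)=S_1\cdots S_k$, a factorization of $L$ of the type $(S_1)\dots(S_k)$ is a factorization $L=F_1\circ\dots\circ F_k$ with $F_i\in K[D_x,D_y]$ and $\mathrm{Sym}(F_i)=S_i$ for all $i$. *)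

theory Defs
  imports "HOL-Algebra.Ring" "HOL-Computational_Algebra.Polynomial"
begin

section \<open>Differential fields with two commuting derivations\<close>

class diff_field = field_char_0 +
  fixes der_x der_y :: "'a \<Rightarrow> 'a"
  assumes der_x_add: "der_x (a + b) = der_x a + der_x b"
    and der_y_add: "der_y (a + b) = der_y a + der_y b"
    and der_x_mult: "der_x (a * b) = der_x a * b + a * der_x b"
    and der_y_mult: "der_y (a * b) = der_y a * b + a * der_y b"
    and der_commute: "der_x (der_y a) = der_y (der_x a)"

text \<open>
  Terms denoting differential polynomials in the unknowns \<open>DVar 0, DVar 1, \<dots>\<close>
  with coefficients in \<open>'a\<close>.
\<close>

datatype 'a dpoly =
    DConst 'a
  | DVar nat
  | DAdd "'a dpoly" "'a dpoly"
  | DMult "'a dpoly" "'a dpoly"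
  | DDer_x "'a dpoly"
  | DDer_y "'a dpoly"

text \<open>
  Evaluation in a structure with addition \<open>pl\<close>, multiplication \<open>tm\<close> and derivations
  \<open>dx\<close>, \<open>dy\<close>; the map \<open>c\<close> embeds the coefficients, \<open>v\<close> assigns values to the unknowns.
\<close>

primrec dpoly_eval ::
  "('e \<Rightarrow> 'e \<Rightarrow> 'e) \<Rightarrow> ('e \<Rightarrow> 'e \<Rightarrow> 'e) \<Rightarrow> ('e \<Rightarrow> 'e) \<Rightarrow> ('e \<Rightarrow> 'e) \<Rightarrow> ('a \<Rightarrow> 'e) \<Rightarrow>
    (nat \<Rightarrow> 'e) \<Rightarrow> 'a dpoly \<Rightarrow> 'e"
  where
    "dpoly_eval pl tm dx dy c v (DConst a) = c a"
  | "dpoly_eval pl tm dx dy c v (DVar n) = v n"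
  | "dpoly_eval pl tm dx dy c v (DAdd p q) =
       pl (dpoly_eval pl tm dx dy c v p) (dpoly_eval pl tm dx dy c v q)"
  | "dpoly_eval pl tm dx dy c v (DMult p q) =
       tm (dpoly_eval pl tm dx dy c v p) (dpoly_eval pl tm dx dy c v q)"
  | "dpoly_eval pl tm dx dy c v (DDer_x p) = dx (dpoly_eval pl tm dx dy c v p)"
  | "dpoly_eval pl tm dx dy c v (DDer_y p) = dy (dpoly_eval pl tm dx dy c v p)"

context diff_field
begin

text \<open>
  \<open>E\<close> is a field with commuting derivations \<open>ex\<close>, \<open>ey\<close>, and \<open>\<phi>\<close> is a homomorphism
  (automatically injective) of differential fields into \<open>E\<close>.
\<close>

definition diff_extension ::
  "('e, 'm) ring_scheme \<Rightarrow> ('e \<Rightarrow> 'e) \<Rightarrow> ('e \<Rightarrow> 'e) \<Rightarrow> ('a \<Rightarrow> 'e) \<Rightarrow> bool"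
  where
    "diff_extension E ex ey \<phi> \<longleftrightarrow>
      Ring.field E \<and>
      (\<forall>a\<in>carrier E. ex a \<in> carrier E \<and> ey a \<in> carrier E \<and> ex (ey a) = ey (ex a)) \<and>
      (\<forall>a\<in>carrier E. \<forall>b\<in>carrier E.
        ex (a \<oplus>\<^bsub>E\<^esub> b) = ex a \<oplus>\<^bsub>E\<^esub> ex b \<and>
        ey (a \<oplus>\<^bsub>E\<^esub> b) = ey a \<oplus>\<^bsub>E\<^esub> ey b \<and>
        ex (a \<otimes>\<^bsub>E\<^esub> b) = ex a \<otimes>\<^bsub>E\<^esub> b \<oplus>\<^bsub>E\<^esub> a \<otimes>\<^bsub>E\<^esub> ex b \<and>
        ey (a \<otimes>\<^bsub>E\<^esub> b) = ey a \<otimes>\<^bsub>E\<^esub> b \<oplus>\<^bsub>E\<^esub> a \<otimes>\<^bsub>E\<^esub> ey b) \<and>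
      \<phi> 1 = \<one>\<^bsub>E\<^esub> \<and>
      (\<forall>a. \<phi> a \<in> carrier E \<and> \<phi> (der_x a) = ex (\<phi> a) \<and> \<phi> (der_y a) = ey (\<phi> a)) \<and>
      (\<forall>a b. \<phi> (a + b) = \<phi> a \<oplus>\<^bsub>E\<^esub> \<phi> b \<and> \<phi> (a * b) = \<phi> a \<otimes>\<^bsub>E\<^esub> \<phi> b)"

definition solvable_in ::
  "('e, 'm) ring_scheme \<Rightarrow> ('e \<Rightarrow> 'e) \<Rightarrow> ('e \<Rightarrow> 'e) \<Rightarrow> ('a \<Rightarrow> 'e) \<Rightarrow> 'a dpoly set \<Rightarrow> bool"
  where
    "solvable_in E ex ey \<phi> P \<longleftrightarrow>
      (\<exists>v. (\<forall>n. v n \<in> carrier E) \<and>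
        (\<forall>p\<in>P. dpoly_eval (\<lambda>a b. a \<oplus>\<^bsub>E\<^esub> b) (\<lambda>a b. a \<otimes>\<^bsub>E\<^esub> b) ex ey \<phi> v p = \<zero>\<^bsub>E\<^esub>))"

definition solvable :: "'a dpoly set \<Rightarrow> bool"
  where "solvable P \<longleftrightarrow> (\<exists>v. \<forall>p\<in>P. dpoly_eval (+) (*) der_x der_y (\<lambda>a. a) v p = 0)"

end

text \<open>
  A differential field is differentially closed if every finite system of (non-linear)
  differential equations over it that is solvable in some differential field extension is
  already solvable in the field itself. An inequation \<open>g \<noteq> 0\<close> can be expressed as the equation
  \<open>g * z - 1 = 0\<close> in a further unknown \<open>z\<close>. Letting the carriers of the extensions range over
  subsets of the type \<open>'a\<close> is no restriction: only extensions generated by finitely many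
  elements matter, and over an infinite field these have the cardinality of the field.
\<close>

class diff_closed_field = diff_field +
  assumes diff_closed:
    "diff_extension (E :: 'a ring) ex ey \<phi> \<Longrightarrow> finite P \<Longrightarrow> solvable_in E ex ey \<phi> P \<Longrightarrow> solvable P"


section \<open>Bivariate polynomials\<close>

text \<open>
  \<open>K[X,Y]\<close> is represented by \<^typ>\<open>'a poly poly\<close>, with \<open>X\<close> the inner and \<open>Y\<close> the outer variable.
\<close>

definition bcoeff :: "'a::zero poly poly \<Rightarrow> nat \<Rightarrow> nat \<Rightarrow> 'a"
  where "bcoeff P i j = coeff (coeff P j) i"

definition homogeneous_of_degree :: "nat \<Rightarrow> 'a::zero poly poly \<Rightarrow> bool"
  where "homogeneous_of_degree d P \<longleftrightarrow> P \<noteq> 0 \<and> (\<forall>i j. bcoeff P i j \<noteq> 0 \<longrightarrow> i + j = d)"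


section \<open>Linear partial differential operators\<close>

text \<open>
  The operator \<open>\<Sum> a\<^sub>i\<^sub>j D\<^sub>x\<^sup>i D\<^sub>y\<^sup>j\<close> is represented by the polynomial \<open>\<Sum> a\<^sub>i\<^sub>j X\<^sup>i Y\<^sup>j\<close>.
\<close>

typedef (overloaded) 'a lpdo = "UNIV :: 'a::zero poly poly set"
  morphisms poly_of_lpdo Lpdo ..

setup_lifting type_definition_lpdo

lift_definition op_coeff :: "'a::zero lpdo \<Rightarrow> nat \<Rightarrow> nat \<Rightarrow> 'a" is bcoeff .

text \<open>
  Composition on the left with \<open>D\<^sub>x\<close> and \<open>D\<^sub>y\<close>, as dictated by \<open>D\<^sub>i a = a D\<^sub>i + \<partial>\<^sub>i(a)\<close>:
  for instance \<open>D\<^sub>x \<circ> a D\<^sub>x\<^sup>i D\<^sub>y\<^sup>j = a D\<^sub>x\<^sup>i\<^sup>+\<^sup>1 D\<^sub>y\<^sup>j + \<partial>\<^sub>x(a) D\<^sub>x\<^sup>i D\<^sub>y\<^sup>j\<close>.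
\<close>

definition left_Dx :: "'a::diff_field poly poly \<Rightarrow> 'a poly poly"
  where "left_Dx P = smult [:0, 1:] P + map_poly (map_poly der_x) P"

definition left_Dy :: "'a::diff_field poly poly \<Rightarrow> 'a poly poly"
  where "left_Dy P = pCons 0 P + map_poly (map_poly der_y) P"

definition op_comp :: "'a::diff_field poly poly \<Rightarrow> 'a poly poly \<Rightarrow> 'a poly poly"
  where
    "op_comp A B =
      (\<Sum>j\<le>degree A. \<Sum>i\<le>degree (coeff A j).
        smult [:bcoeff A i j:] ((left_Dx ^^ i) ((left_Dy ^^ j) B)))"

lemma der_0 [simp]: "der_x (0::'a::diff_field) = 0" "der_y (0::'a) = 0"
  using der_x_add[of "0::'a" 0] der_y_add[of "0::'a" 0] by simp_all

lemma der_1 [simp]: "der_x (1::'a::diff_field) = 0" "der_y (1::'a) = 0"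
  using der_x_mult[of "1::'a" 1] der_y_mult[of "1::'a" 1] by simp_all

lemma bcoeff_eqI: "(\<And>i j. bcoeff P i j = bcoeff Q i j) \<Longrightarrow> P = Q"
  by (auto simp: bcoeff_def poly_eq_iff)

lemma bcoeff_left_Dx:
  "bcoeff (left_Dx P) i j = (case i of 0 \<Rightarrow> 0 | Suc k \<Rightarrow> bcoeff P k j) + der_x (bcoeff P i j)"
  by (simp add: bcoeff_def left_Dx_def coeff_map_poly coeff_pCons split: nat.split)

lemma bcoeff_left_Dy:
  "bcoeff (left_Dy P) i j = (case j of 0 \<Rightarrow> 0 | Suc k \<Rightarrow> bcoeff P i k) + der_y (bcoeff P i j)"
  by (simp add: bcoeff_def left_Dy_def coeff_map_poly coeff_pCons split: nat.split)

lemma bcoeff_add: "bcoeff (P + Q) i j = bcoeff P i j + bcoeff Q i j"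
  by (simp add: bcoeff_def)

lemma bcoeff_smult: "bcoeff (smult [:a:] P) i j = a * bcoeff P i j"
  by (simp add: bcoeff_def)

lemmas bcoeff_simps = bcoeff_add bcoeff_smult bcoeff_left_Dx bcoeff_left_Dy

lemma left_0 [simp]: "left_Dx 0 = 0" "left_Dy 0 = 0"
  by (simp_all add: left_Dx_def left_Dy_def)

lemma left_add: "left_Dx (P + Q) = left_Dx P + left_Dx Q" "left_Dy (P + Q) = left_Dy P + left_Dy Q"
  by (rule bcoeff_eqI; simp add: bcoeff_simps der_x_add der_y_add split: nat.split)+

lemma left_smult:
  "left_Dx (smult [:a:] P) = smult [:a:] (left_Dx P) + smult [:der_x a:] P"
  "left_Dy (smult [:a:] P) = smult [:a:] (left_Dy P) + smult [:der_y a:] P"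
  by (rule bcoeff_eqI; simp add: bcoeff_simps der_x_mult der_y_mult algebra_simps split: nat.split)+

lemma left_Dx_left_Dy: "left_Dx (left_Dy P) = left_Dy (left_Dx P)"
  by (rule bcoeff_eqI)
    (simp add: bcoeff_simps der_commute der_x_add der_y_add algebra_simps split: nat.split)

definition op_comp_inner :: "'a::diff_field poly \<Rightarrow> 'a poly poly \<Rightarrow> 'a poly poly"
  where "op_comp_inner p B = (\<Sum>i\<le>degree p. smult [:coeff p i:] ((left_Dx ^^ i) B))"

lemma op_comp_inner_bound:
  "degree p \<le> N \<Longrightarrow> op_comp_inner p B = (\<Sum>i\<le>N. smult [:coeff p i:] ((left_Dx ^^ i) B))"
  unfolding op_comp_inner_def
  by (rule sum.mono_neutral_left) (auto simp: coeff_eq_0)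

lemma op_comp_inner_0 [simp]: "op_comp_inner 0 B = 0"
  by (simp add: op_comp_inner_def)

lemma op_comp_alt: "op_comp A B = (\<Sum>j\<le>degree A. op_comp_inner (coeff A j) ((left_Dy ^^ j) B))"
  by (simp add: op_comp_def op_comp_inner_def bcoeff_def)

lemma op_comp_bound:
  "degree A \<le> N \<Longrightarrow> op_comp A B = (\<Sum>j\<le>N. op_comp_inner (coeff A j) ((left_Dy ^^ j) B))"
  unfolding op_comp_alt
  by (rule sum.mono_neutral_left) (auto simp: coeff_eq_0)

lemma op_comp_inner_pCons:
  "op_comp_inner (pCons a p) B = smult [:a:] B + op_comp_inner p (left_Dx B)"
proof -
  have "op_comp_inner (pCons a p) B =
      (\<Sum>i\<le>Suc (degree p). smult [:coeff (pCons a p) i:] ((left_Dx ^^ i) B))"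
    by (rule op_comp_inner_bound) (simp add: degree_pCons_le)
  then show ?thesis
    by (simp add: sum.atMost_Suc_shift op_comp_inner_def funpow_Suc_right del: sum.atMost_Suc funpow.simps(2))
qed

lemma op_comp_pCons: "op_comp (pCons p A) B = op_comp_inner p B + op_comp A (left_Dy B)"
proof -
  have "op_comp (pCons p A) B =
      (\<Sum>j\<le>Suc (degree A). op_comp_inner (coeff (pCons p A) j) ((left_Dy ^^ j) B))"
    by (rule op_comp_bound) (simp add: degree_pCons_le)
  then show ?thesis
    by (simp add: sum.atMost_Suc_shift op_comp_alt funpow_Suc_right del: sum.atMost_Suc funpow.simps(2))
qed

lemma op_comp_0 [simp]: "op_comp 0 B = 0"
  by (simp add: op_comp_alt)

lemma op_comp_inner_add_left: "op_comp_inner (p + q) B = op_comp_inner p B + op_comp_inner q B"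
proof -
  let ?N = "max (degree p) (degree q)"
  have *: "[:a + b:] = [:a:] + [:b:]" for a b :: 'a by simp
  have "degree (p + q) \<le> ?N" by (rule degree_add_le_max)
  then show ?thesis
    by (simp add: op_comp_inner_bound[of _ ?N] sum.distrib[symmetric] * smult_add_left del: add_pCons)
qed

lemma op_comp_add_left: "op_comp (A + A') B = op_comp A B + op_comp A' B"
proof -
  let ?N = "max (degree A) (degree A')"
  have "degree (A + A') \<le> ?N" by (rule degree_add_le_max)
  then show ?thesis
    by (simp add: op_comp_bound[of _ ?N] op_comp_inner_add_left sum.distrib)
qed

lemma op_comp_inner_add_right: "op_comp_inner p (B + C) = op_comp_inner p B + op_comp_inner p C"
  by (induction p arbitrary: B C)
    (auto simp: op_comp_inner_pCons left_add smult_add_right algebra_simps)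

lemma op_comp_add_right: "op_comp A (B + C) = op_comp A B + op_comp A C"
  by (induction A arbitrary: B C)
    (auto simp: op_comp_pCons op_comp_inner_add_right left_add algebra_simps)

lemma op_comp_inner_smult: "op_comp_inner (smult a p) B = smult [:a:] (op_comp_inner p B)"
  by (induction p arbitrary: B) (auto simp: op_comp_inner_pCons smult_add_right mult.commute)

lemma op_comp_smult: "op_comp (smult [:a:] A) B = smult [:a:] (op_comp A B)"
  by (induction A arbitrary: B) (auto simp: op_comp_pCons op_comp_inner_smult smult_add_right)

lemma op_comp_inner_left_Dx:
  "op_comp_inner (pCons 0 p + map_poly der_x p) B = left_Dx (op_comp_inner p B)"
proof (induction p arbitrary: B)
  case 0
  then show ?case by simp
next
  case (pCons a p)
  have "pCons 0 (pCons a p) + map_poly der_x (pCons a p) =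
      pCons (der_x a) ([:a:] + (pCons 0 p + map_poly der_x p))"
    by (rule poly_eqI) (auto simp: coeff_map_poly coeff_pCons split: nat.split)
  then show ?case
    by (simp only: op_comp_inner_pCons op_comp_inner_add_left[of "[:a:]"] pCons.IH)
      (simp add: op_comp_inner_pCons left_add left_smult algebra_simps)
qed

lemma op_comp_left_Dx: "op_comp (left_Dx A) B = left_Dx (op_comp A B)"
proof (induction A arbitrary: B)
  case 0
  then show ?case by simp
next
  case (pCons p A)
  have "left_Dx (pCons p A) = pCons (pCons 0 p + map_poly der_x p) (left_Dx A)"
    by (rule poly_eqI; rule poly_eqI)
      (auto simp: left_Dx_def coeff_map_poly coeff_pCons split: nat.split)
  then show ?case
    by (simp only: op_comp_pCons op_comp_inner_left_Dx pCons.IH left_add)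
qed

lemma op_comp_inner_left_Dy:
  "left_Dy (op_comp_inner p B) = op_comp_inner (map_poly der_y p) B + op_comp_inner p (left_Dy B)"
proof (induction p arbitrary: B)
  case 0
  then show ?case by simp
next
  case (pCons a p)
  have "map_poly der_y (pCons a p) = pCons (der_y a) (map_poly der_y p)"
    by (rule poly_eqI) (auto simp: coeff_map_poly coeff_pCons split: nat.split)
  then show ?case
    by (simp add: op_comp_inner_pCons left_add left_smult pCons.IH left_Dx_left_Dy algebra_simps)
qed

lemma op_comp_left_Dy: "op_comp (left_Dy A) B = left_Dy (op_comp A B)"
proof (induction A arbitrary: B)
  case 0
  then show ?case by simp
next
  case (pCons p A)
  have "left_Dy (pCons p A) = pCons (map_poly der_y p) ([:p:] + left_Dy A)"
    by (rule poly_eqI; rule poly_eqI)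
      (auto simp: left_Dy_def coeff_map_poly coeff_pCons split: nat.split)
  then show ?case
    by (simp only: op_comp_pCons op_comp_add_left[of "[:p:]"] pCons.IH left_add)
      (simp add: op_comp_pCons op_comp_inner_left_Dy algebra_simps)
qed

lemma op_comp_inner_assoc: "op_comp (op_comp_inner p B) C = op_comp_inner p (op_comp B C)"
  by (induction p arbitrary: B)
    (auto simp: op_comp_inner_pCons op_comp_add_left op_comp_smult op_comp_left_Dx)

lemma op_comp_assoc: "op_comp (op_comp A B) C = op_comp A (op_comp B C)"
  by (induction A arbitrary: B)
    (auto simp: op_comp_pCons op_comp_add_left op_comp_inner_assoc op_comp_left_Dy)

lemma bcoeff_monom: "bcoeff (monom p j) k l = (if l = j then coeff p k else 0)"
  by (simp add: bcoeff_def)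

lemma smult_one_const [simp]: "smult [:1:] P = (P :: 'a::comm_semiring_1 poly poly)"
  unfolding one_pCons[symmetric] by (rule smult_1_left)

lemma left_Dx_monom: "left_Dx (monom (monom 1 i) j) = monom (monom 1 (Suc i)) j"
  by (rule bcoeff_eqI) (auto simp: bcoeff_left_Dx bcoeff_monom split: nat.split)

lemma left_Dy_monom: "left_Dy (monom (monom 1 i) j) = monom (monom 1 i) (Suc j)"
  by (rule bcoeff_eqI) (auto simp: bcoeff_left_Dy bcoeff_monom split: nat.split)

lemma left_Dx_pow_monom: "(left_Dx ^^ k) (monom (monom 1 i) j) = monom (monom 1 (i + k)) j"
  by (induction k) (simp_all add: left_Dx_monom)

lemma left_Dy_pow_monom: "(left_Dy ^^ k) (monom (monom 1 i) j) = monom (monom 1 i) (j + k)"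
  by (induction k) (simp_all add: left_Dy_monom)

lemma pow_left_1:
  "(left_Dx ^^ i) ((left_Dy ^^ j) (1 :: 'a::diff_field poly poly)) = monom (monom 1 i) j"
proof -
  have "(1 :: 'a poly poly) = monom (monom 1 0) 0"
    by (simp add: one_pCons monom_0)
  then have "(left_Dx ^^ i) ((left_Dy ^^ j) (1 :: 'a poly poly)) =
      (left_Dx ^^ i) ((left_Dy ^^ j) (monom (monom 1 0) 0))"
    by (rule arg_cong)
  also have "\<dots> = monom (monom 1 i) j"
    by (simp only: left_Dx_pow_monom left_Dy_pow_monom add_0)
  finally show ?thesis .
qed

lemma op_comp_const: "op_comp [:[:a:]:] B = smult [:a:] B"
  by (simp add: op_comp_pCons op_comp_inner_pCons)

lemma op_comp_1_left: "op_comp 1 B = B"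
  by (simp add: one_pCons op_comp_const)

lemma op_comp_1_right: "op_comp A 1 = A"
proof -
  have inner: "(\<Sum>i\<le>degree p. smult [:coeff p i:] (monom (monom 1 i) j)) = monom p j"
    for p :: "'a poly" and j
  proof -
    have "(\<Sum>i\<le>degree p. smult [:coeff p i:] (monom (monom 1 i) j)) =
        (\<Sum>i\<le>degree p. monom (monom (coeff p i) i) j)"
      by (simp add: smult_monom)
    also have "\<dots> = monom (\<Sum>i\<le>degree p. monom (coeff p i) i) j"
      by (rule poly_eqI) (simp add: coeff_sum)
    finally show ?thesis by (simp add: poly_as_sum_of_monoms)
  qed
  show ?thesis
    by (simp add: op_comp_def bcoeff_def pow_left_1 inner poly_as_sum_of_monoms)
qed

instantiation lpdo :: (diff_field) ring_1
begin

lift_definition zero_lpdo :: "'a lpdo" is 0 .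
lift_definition one_lpdo :: "'a lpdo" is 1 .
lift_definition plus_lpdo :: "'a lpdo \<Rightarrow> 'a lpdo \<Rightarrow> 'a lpdo" is "(+)" .
lift_definition minus_lpdo :: "'a lpdo \<Rightarrow> 'a lpdo \<Rightarrow> 'a lpdo" is "(-)" .
lift_definition uminus_lpdo :: "'a lpdo \<Rightarrow> 'a lpdo" is uminus .
lift_definition times_lpdo :: "'a lpdo \<Rightarrow> 'a lpdo \<Rightarrow> 'a lpdo" is op_comp .

instance
  by standard
    (transfer; simp add: op_comp_assoc op_comp_add_left op_comp_add_right
      op_comp_1_left op_comp_1_right)+

end

lift_definition op_const :: "'a::diff_field \<Rightarrow> 'a lpdo" is "\<lambda>a. [:[:a:]:]" .
lift_definition Dx :: "'a::diff_field lpdo" is "monom (monom 1 1) 0" .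
lift_definition Dy :: "'a::diff_field lpdo" is "monom (monom 1 0) 1" .

lemma op_const_hom:
  "op_const 1 = 1" "op_const (a + b) = op_const a + op_const b"
  "op_const (a * b) = op_const a * op_const b"
  by (transfer; simp add: one_pCons op_comp_const)+

lemma Dx_times: "poly_of_lpdo (Dx * L) = left_Dx (poly_of_lpdo L)"
proof -
  have "poly_of_lpdo (Dx :: 'a lpdo) = pCons (pCons 0 [:1:]) 0"
    by (simp add: Dx.rep_eq monom_Suc monom_0)
  then show ?thesis
    by (simp add: times_lpdo.rep_eq op_comp_pCons op_comp_inner_pCons)
qed

lemma Dy_times: "poly_of_lpdo (Dy * L) = left_Dy (poly_of_lpdo L)"
proof -
  have "poly_of_lpdo (Dy :: 'a lpdo) = pCons 0 (pCons [:1:] 0)"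
    by (simp add: Dy.rep_eq monom_Suc monom_0)
  then show ?thesis
    by (simp add: times_lpdo.rep_eq op_comp_pCons op_comp_inner_pCons)
qed

lemma op_const_times: "poly_of_lpdo (op_const a * L) = smult [:a:] (poly_of_lpdo L)"
  by (simp add: times_lpdo.rep_eq op_const.rep_eq op_comp_const)

lemma Dx_Dy: "Dx * Dy = (Dy * Dx :: 'a::diff_field lpdo)"
proof -
  have "left_Dx (monom (monom 1 0) 1) = left_Dy (monom (monom (1::'a) 1) 0)"
    by (simp only: left_Dx_monom left_Dy_monom One_nat_def)
  then show ?thesis
    by (simp only: poly_of_lpdo_inject[symmetric] Dx_times Dy_times Dx.rep_eq Dy.rep_eq)
qed

lemma op_coeff_mult_simps:
  "op_coeff (L + M) i j = op_coeff L i j + op_coeff M i j"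
  "op_coeff (op_const a * L) i j = a * op_coeff L i j"
  "op_coeff (Dx * L) i j = (case i of 0 \<Rightarrow> 0 | Suc k \<Rightarrow> op_coeff L k j) + der_x (op_coeff L i j)"
  "op_coeff (Dy * L) i j = (case j of 0 \<Rightarrow> 0 | Suc k \<Rightarrow> op_coeff L i k) + der_y (op_coeff L i j)"
  by (simp_all add: op_coeff.rep_eq plus_lpdo.rep_eq op_const_times Dx_times Dy_times
      bcoeff_simps split: nat.split)

lemma op_coeff_gens:
  "op_coeff (op_const a) i j = (if i = 0 \<and> j = 0 then a else 0)"
  "op_coeff Dx i j = (if i = 1 \<and> j = 0 then 1 else (0::'a::diff_field))"
  "op_coeff Dy i j = (if i = 0 \<and> j = 1 then 1 else (0::'a))"
  by (auto simp: op_coeff.rep_eq op_const.rep_eq Dx.rep_eq Dy.rep_eq bcoeff_def coeff_pCons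
      split: nat.split)

lemma op_coeff_eq_iff: "L = M \<longleftrightarrow> (\<forall>i j. op_coeff L i j = op_coeff M i j)"
  by transfer (auto intro: bcoeff_eqI)

lemma Dx_op_const: "Dx * op_const a = op_const a * Dx + op_const (der_x a)"
  by (auto simp: op_coeff_eq_iff op_coeff_mult_simps op_coeff_gens split: nat.split)

lemma Dy_op_const: "Dy * op_const a = op_const a * Dy + op_const (der_y a)"
  by (auto simp: op_coeff_eq_iff op_coeff_mult_simps op_coeff_gens split: nat.split)

lemma op_coeff_monomial:
  "op_coeff (op_const a * Dx ^ i * Dy ^ j) k l = (if k = i \<and> l = j then a else 0)"
proof -
  have x: "poly_of_lpdo (Dx ^ i * M) = (left_Dx ^^ i) (poly_of_lpdo M)" for M :: "'a lpdo"
    by (induction i) (simp_all add: Dx_times mult.assoc)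
  have y: "poly_of_lpdo (Dy ^ j :: 'a lpdo) = (left_Dy ^^ j) 1"
    by (induction j) (simp_all add: Dy_times one_lpdo.rep_eq)
  show ?thesis
    by (simp add: op_coeff.rep_eq mult.assoc op_const_times x y pow_left_1 bcoeff_smult)
      (simp add: bcoeff_def)
qed

lemma finite_op_support: "finite {(i, j). op_coeff L i j \<noteq> 0}"
proof -
  let ?P = "poly_of_lpdo L"
  have "{(i, j). op_coeff L i j \<noteq> 0} \<subseteq> (\<Union>j\<in>{..degree ?P}. (\<lambda>i. (i, j)) ` {..degree (coeff ?P j)})"
    by (auto simp: op_coeff.rep_eq bcoeff_def image_iff) (metis coeff_0 le_degree, metis le_degree)
  then show ?thesis
    by (rule finite_subset) auto
qed

text \<open>The zero operator is given order 0.\<close>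

definition op_order :: "'a::zero lpdo \<Rightarrow> nat"
  where "op_order L = Max (insert 0 {i + j | i j. op_coeff L i j \<noteq> 0})"

definition symbol :: "'a::comm_monoid_add lpdo \<Rightarrow> 'a poly poly"
  where "symbol L = (\<Sum>i\<le>op_order L. monom (monom (op_coeff L i (op_order L - i)) i) (op_order L - i))"

definition is_left_factor :: "'a::diff_field lpdo \<Rightarrow> 'a lpdo \<Rightarrow> bool"
  where "is_left_factor F L \<longleftrightarrow> (\<exists>G. L = F * G)"

definition is_right_factor :: "'a::diff_field lpdo \<Rightarrow> 'a lpdo \<Rightarrow> bool"
  where "is_right_factor F L \<longleftrightarrow> (\<exists>G. L = G * F)"

definition has_factorization_of_type :: "'a::diff_field lpdo \<Rightarrow> 'a poly poly list \<Rightarrow> bool"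
  where
    "has_factorization_of_type L Ss \<longleftrightarrow>
      symbol L = prod_list Ss \<and> (\<exists>Fs. L = prod_list Fs \<and> map symbol Fs = Ss)"

end

theory Submission
  imports Defs
begin

text \<open>
  Passing from an operator to its symbol turns composition into the commutative product of
  \<open>K[X,Y]\<close>: filtered by order, the ring of operators has \<open>K[X,Y]\<close> as its graded ring
  (\<open>op_comp_approx\<close>, \<open>symbol_mult\<close>).

  In a factorization of type \<open>(S\<^sub>1)(T)(S\<^sub>2)\<close> the outer operators are the required factors; they
  have order one because the degree of a nonzero symbol is the order of the operator.

  For the converse let \<open>L = F\<^sub>1 \<circ> G = H \<circ> F\<^sub>2\<close>. Left composition with \<open>F\<^sub>1\<close> acts on the operators
  modulo the left ideal generated by \<open>F\<^sub>2\<close>. On the graded level this is multiplication by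
  \<open>S\<^sub>1\<close> on \<open>K[X,Y]/(S\<^sub>2)\<close>, which is injective since \<open>S\<^sub>2\<close> is prime and does not divide \<open>S\<^sub>1\<close>.
  Injectivity lifts from the graded module to the filtered one (\<open>right_factor_cancel\<close>):
  comparing symbols in \<open>F\<^sub>1 \<circ> G = H \<circ> F\<^sub>2\<close> shows that \<open>S\<^sub>2\<close> divides the symbol of \<open>G\<close>, so
  subtracting a suitable \<open>Q \<circ> F\<^sub>2\<close> from \<open>G\<close> lowers its order without disturbing the situation,
  and one descends until nothing is left. Hence \<open>F\<^sub>2\<close> is a right factor of \<open>G\<close>, and \<open>L\<close> factors
  with the given \<open>F\<^sub>1\<close> and \<open>F\<^sub>2\<close> at its two ends.
\<close>

section \<open>Total degree of bivariate polynomials\<close>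

text \<open>
  A strict bound lets the zero polynomial satisfy every bound, including \<open>0\<close>, so that the
  orders of error terms can be stated without case distinctions.
\<close>

definition degree_below :: "nat \<Rightarrow> 'a::zero poly poly \<Rightarrow> bool"
  where "degree_below n P \<longleftrightarrow> (\<forall>i j. bcoeff P i j \<noteq> 0 \<longrightarrow> i + j < n)"

lemma degree_belowI: "(\<And>i j. bcoeff P i j \<noteq> 0 \<Longrightarrow> i + j < n) \<Longrightarrow> degree_below n P"
  by (auto simp: degree_below_def)

lemma degree_belowD: "degree_below n P \<Longrightarrow> bcoeff P i j \<noteq> 0 \<Longrightarrow> i + j < n"
  by (auto simp: degree_below_def)

lemma bcoeff_0 [simp]: "bcoeff 0 i j = 0"
  by (simp add: bcoeff_def)

lemma bcoeff_diff: "bcoeff (P - Q) i j = bcoeff P i j - bcoeff Q i j"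
  for P Q :: "'a::ab_group_add poly poly"
  by (simp add: bcoeff_def)

lemma bcoeff_mult:
  "bcoeff (P * Q) i j = (\<Sum>l\<le>j. \<Sum>k\<le>i. bcoeff P k l * bcoeff Q (i - k) (j - l))"
  for P Q :: "'a::comm_semiring_0 poly poly"
  by (simp add: bcoeff_def coeff_mult coeff_sum)

lemma bcoeff_mult_nonzeroE:
  fixes P Q :: "'a::comm_semiring_0 poly poly"
  assumes "bcoeff (P * Q) i j \<noteq> 0"
  obtains k l where "k \<le> i" "l \<le> j" "bcoeff P k l \<noteq> 0" "bcoeff Q (i - k) (j - l) \<noteq> 0"
proof -
  have "\<exists>l\<in>{..j}. \<exists>k\<in>{..i}. bcoeff P k l * bcoeff Q (i - k) (j - l) \<noteq> 0"
  proof (rule ccontr)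
    assume "\<not> ?thesis"
    then have "bcoeff (P * Q) i j = 0"
      unfolding bcoeff_mult by (intro sum.neutral ballI) auto
    with assms show False by simp
  qed
  then show ?thesis using that by fastforce
qed

lemma degree_below_0_iff: "degree_below 0 P \<longleftrightarrow> P = 0"
  by (auto simp: degree_below_def intro!: bcoeff_eqI)

lemma degree_below_zero [simp]: "degree_below n 0"
  by (simp add: degree_below_def)

lemma degree_below_mono: "degree_below m P \<Longrightarrow> m \<le> n \<Longrightarrow> degree_below n P"
  by (meson degree_below_def less_le_trans)

lemma degree_below_add:
  "degree_below n P \<Longrightarrow> degree_below n Q \<Longrightarrow> degree_below n (P + Q)"
  for P Q :: "'a::comm_monoid_add poly poly"
proof (rule degree_belowI)
  fix i j
  assume "degree_below n P" "degree_below n Q" "bcoeff (P + Q) i j \<noteq> 0"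
  then show "i + j < n"
    by (cases "bcoeff P i j = 0") (auto simp: bcoeff_def degree_below_def)
qed

lemma degree_below_diff:
  "degree_below n P \<Longrightarrow> degree_below n Q \<Longrightarrow> degree_below n (P - Q)"
  for P Q :: "'a::ab_group_add poly poly"
proof (rule degree_belowI)
  fix i j
  assume "degree_below n P" "degree_below n Q" "bcoeff (P - Q) i j \<noteq> 0"
  then show "i + j < n"
    by (cases "bcoeff P i j = 0") (auto simp: bcoeff_def degree_below_def)
qed

lemma degree_below_sum:
  "(\<And>x. x \<in> A \<Longrightarrow> degree_below n (f x)) \<Longrightarrow> degree_below n (sum f A)"
  for f :: "'b \<Rightarrow> 'a::comm_monoid_add poly poly"
  by (induction A rule: infinite_finite_induct) (auto intro: degree_below_add)

lemma degree_below_smult: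
  "degree_below n P \<Longrightarrow> degree_below n (smult [:a:] P)"
  for P :: "'a::comm_semiring_0 poly poly"
  unfolding degree_below_def by (metis bcoeff_smult mult_zero_right)

lemma degree_below_mult:
  fixes P Q :: "'a::comm_semiring_0 poly poly"
  assumes P: "degree_below (Suc m) P" and Q: "degree_below n Q"
  shows "degree_below (m + n) (P * Q)"
proof (rule degree_belowI)
  fix i j assume "bcoeff (P * Q) i j \<noteq> 0"
  then obtain k l where "k \<le> i" "l \<le> j" "bcoeff P k l \<noteq> 0" "bcoeff Q (i - k) (j - l) \<noteq> 0"
    by (rule bcoeff_mult_nonzeroE)
  with degree_belowD[OF P, of k l] degree_belowD[OF Q, of "i - k" "j - l"]
  show "i + j < m + n" by linarith
qed

lemma homogeneous_imp_degree_below: "homogeneous_of_degree n P \<Longrightarrow> degree_below (Suc n) P"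
  by (auto simp: homogeneous_of_degree_def degree_below_def)

lemma homogeneous_of_degree_unique:
  assumes "homogeneous_of_degree m P" "homogeneous_of_degree n P"
  shows "m = n"
proof -
  from assms(1) obtain i j where "bcoeff P i j \<noteq> 0"
    unfolding homogeneous_of_degree_def by (metis bcoeff_0 bcoeff_eqI)
  with assms show ?thesis by (auto simp: homogeneous_of_degree_def)
qed

lemma homogeneous_of_degree_mult:
  fixes P Q :: "'a::idom poly poly"
  assumes P: "homogeneous_of_degree m P" and Q: "homogeneous_of_degree n Q"
  shows "homogeneous_of_degree (m + n) (P * Q)"
  unfolding homogeneous_of_degree_def
proof (intro conjI allI impI)
  show "P * Q \<noteq> 0" using P Q by (simp add: homogeneous_of_degree_def)
  fix i j assume "bcoeff (P * Q) i j \<noteq> 0"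
  then obtain k l where kl: "k \<le> i" "l \<le> j" "bcoeff P k l \<noteq> 0" "bcoeff Q (i - k) (j - l) \<noteq> 0"
    by (rule bcoeff_mult_nonzeroE)
  with P Q have "k + l = m" "(i - k) + (j - l) = n"
    unfolding homogeneous_of_degree_def by blast+
  with kl show "i + j = m + n" by linarith
qed

definition homogeneous_part :: "nat \<Rightarrow> 'a::comm_monoid_add poly poly \<Rightarrow> 'a poly poly"
  where "homogeneous_part n P = (\<Sum>i\<le>n. monom (monom (bcoeff P i (n - i)) i) (n - i))"

lemma bcoeff_homogeneous_part:
  "bcoeff (homogeneous_part n P) i j = (if i + j = n then bcoeff P i j else 0)"
proof -
  have "bcoeff (homogeneous_part n P) i j =
      (\<Sum>k\<le>n. bcoeff (monom (monom (bcoeff P k (n - k)) k) (n - k)) i j)"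
    by (simp add: homogeneous_part_def bcoeff_def coeff_sum)
  also have "\<dots> = (\<Sum>k\<le>n. if k = i then (if i + j = n then bcoeff P i j else 0) else 0)"
    by (rule sum.cong) (auto simp: bcoeff_monom)
  also have "\<dots> = (if i + j = n then bcoeff P i j else 0)"
    by auto
  finally show ?thesis .
qed

text \<open>
  Over a domain, a factor of a homogeneous polynomial is homogeneous. If \<open>H\<close> is the part of \<open>Q\<close>
  of the expected degree, then \<open>P * (Q - H)\<close> has no monomials of degree \<open>n\<close>, while both \<open>P * Q\<close>
  and \<open>P * H\<close> have only such monomials; so the product vanishes, and \<open>Q = H\<close>.
\<close>

lemma homogeneous_factor:
  fixes P Q :: "'a::idom poly poly"
  assumes P: "homogeneous_of_degree m P" and PQ: "homogeneous_of_degree n (P * Q)"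
  shows "m \<le> n" and "homogeneous_of_degree (n - m) Q"
proof -
  from PQ obtain i j where ij: "bcoeff (P * Q) i j \<noteq> 0" "i + j = n"
    unfolding homogeneous_of_degree_def by (metis bcoeff_0 bcoeff_eqI)
  then obtain k l where "k \<le> i" "l \<le> j" "bcoeff P k l \<noteq> 0"
    by (blast elim: bcoeff_mult_nonzeroE)
  moreover from this have "k + l = m"
    using P by (simp add: homogeneous_of_degree_def)
  ultimately show mn: "m \<le> n" using ij by linarith
  let ?H = "homogeneous_part (n - m) Q"
  have "bcoeff (P * (Q - ?H)) i j = 0" for i j
  proof (rule ccontr)
    assume nz: "bcoeff (P * (Q - ?H)) i j \<noteq> 0"
    then obtain k l where kl: "k \<le> i" "l \<le> j" "bcoeff P k l \<noteq> 0"
        "bcoeff (Q - ?H) (i - k) (j - l) \<noteq> 0"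
      by (rule bcoeff_mult_nonzeroE)
    then have "k + l = m" "(i - k) + (j - l) \<noteq> n - m"
      using P by (auto simp: homogeneous_of_degree_def bcoeff_diff bcoeff_homogeneous_part
          split: if_splits)
    with kl have ij: "i + j \<noteq> n" by linarith
    then have "bcoeff (P * Q) i j = 0"
      using PQ by (auto simp: homogeneous_of_degree_def)
    with nz have "bcoeff (P * ?H) i j \<noteq> 0"
      by (simp add: right_diff_distrib bcoeff_diff)
    then obtain k l where kl: "k \<le> i" "l \<le> j" "bcoeff P k l \<noteq> 0" "bcoeff ?H (i - k) (j - l) \<noteq> 0"
      by (rule bcoeff_mult_nonzeroE)
    then have "k + l = m" "(i - k) + (j - l) = n - m"
      using P by (auto simp: homogeneous_of_degree_def bcoeff_homogeneous_part split: if_splits)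
    with kl mn ij show False by linarith
  qed
  then have "P * (Q - ?H) = 0" by (intro bcoeff_eqI) simp
  then have "Q = ?H" using P by (simp add: homogeneous_of_degree_def)
  moreover have "Q \<noteq> 0" using PQ by (auto simp: homogeneous_of_degree_def)
  ultimately show "homogeneous_of_degree (n - m) Q"
    unfolding homogeneous_of_degree_def by (metis bcoeff_homogeneous_part)
qed


section \<open>Linear forms are prime\<close>

lemma linear_form_eq:
  fixes S :: "'a::zero poly poly"
  assumes "homogeneous_of_degree 1 S"
  obtains c d where "S = [:[:0, c:], [:d:]:]" "c \<noteq> 0 \<or> d \<noteq> 0"
proof
  show S: "S = [:[:0, bcoeff S 1 0:], [:bcoeff S 0 1:]:]"
  proof (rule bcoeff_eqI)
    fix i j
    have "bcoeff S i j = 0" if "i + j \<noteq> 1"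
      using assms that by (auto simp: homogeneous_of_degree_def)
    then show "bcoeff S i j = bcoeff [:[:0, bcoeff S 1 0:], [:bcoeff S 0 1:]:] i j"
      by (auto simp: bcoeff_def coeff_pCons split: nat.split)
  qed
  show "bcoeff S 1 0 \<noteq> 0 \<or> bcoeff S 0 1 \<noteq> 0"
    using assms S by (auto simp: homogeneous_of_degree_def)
qed

text \<open>
  A linear polynomial with invertible leading coefficient divides \<open>P\<close> exactly when \<open>P\<close> vanishes
  at its root, and the polynomials vanishing at a point of a domain form a prime ideal.
\<close>

lemma prime_elem_linear_poly_unit_lead:
  fixes p u :: "'a::idom_divide"
  assumes "u dvd 1"
  shows "prime_elem [:p, u:]"
proof -
  from assms obtain v where v: "1 = u * v" by (rule dvdE)
  have eq: "[:p, u:] = smult u [:- (- (v * p)), 1:]"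
    using v by (simp add: mult.assoc[symmetric])
  have dvd_iff: "[:p, u:] dvd P \<longleftrightarrow> poly P (- (v * p)) = 0" for P
  proof -
    have "[:u:] dvd 1" using assms by (simp add: is_unit_const_poly_iff)
    moreover have "[:p, u:] = [:u:] * [:- (- (v * p)), 1:]" unfolding eq by simp
    ultimately show ?thesis unfolding poly_eq_0_iff_dvd by (metis mult_unit_dvd_iff')
  qed
  from v have "u \<noteq> 0" by auto
  then show ?thesis
    by (auto simp: prime_elem_def dvd_iff)
qed

text \<open>
  A form \<open>c X + d Y\<close> with \<open>d \<noteq> 0\<close> is linear in the outer variable with invertible leading
  coefficient; otherwise it is \<open>c X\<close>, a prime of \<open>K[X]\<close>, which stays prime in \<open>K[X][Y]\<close>.
\<close>

lemma prime_elem_linear_form: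
  fixes S :: "'a::field poly poly"
  assumes "homogeneous_of_degree 1 S"
  shows "prime_elem S"
proof -
  from assms obtain c d where S: "S = [:[:0, c:], [:d:]:]" and cd: "c \<noteq> 0 \<or> d \<noteq> 0"
    by (rule linear_form_eq)
  show ?thesis
  proof (cases "d = 0")
    case True
    with cd have "prime_elem [:0, c:]"
      by (intro prime_elem_linear_poly_unit_lead) (simp add: dvd_field_iff)
    then show ?thesis using True by (simp add: S lift_prime_elem_poly)
  next
    case False
    then show ?thesis unfolding S
      by (intro prime_elem_linear_poly_unit_lead) (simp add: is_unit_const_poly_iff dvd_field_iff)
  qed
qed


section \<open>Symbols\<close>

lemma degree_below_map_der:
  fixes P :: "'a::diff_field poly poly"
  assumes "degree_below n P"
  shows "degree_below n (map_poly (map_poly der_x) P)" "degree_below n (map_poly (map_poly der_y) P)"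
  using assms unfolding degree_below_def bcoeff_def
  by (simp add: coeff_map_poly, metis der_0)+

lemma degree_below_shift:
  fixes P :: "'a::comm_semiring_1 poly poly"
  assumes "degree_below n P"
  shows "degree_below (Suc n) (smult [:0, 1:] P)" "degree_below (Suc n) (pCons 0 P)"
  using assms unfolding degree_below_def bcoeff_def
  by (auto simp: coeff_pCons split: nat.splits)

lemma degree_below_left:
  assumes "degree_below n P"
  shows "degree_below (Suc n) (left_Dx P)" "degree_below (Suc n) (left_Dy P)"
  unfolding left_Dx_def left_Dy_def
  using degree_below_map_der[OF assms] degree_below_shift[OF assms]
  by (auto intro!: degree_below_add elim: degree_below_mono)

text \<open>
  If \<open>P\<close> agrees with \<open>Q\<close> up to lower order, then so do \<open>D\<^sub>x \<circ> P\<close> and \<open>X * Q\<close>: the derivation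
  acting on the coefficients contributes only terms of the order of \<open>Q\<close>.
\<close>

lemma left_approx_step:
  fixes P Q :: "'a::diff_field poly poly"
  assumes PQ: "degree_below n (P - Q)" and Q: "degree_below (Suc n) Q"
  shows "degree_below (Suc n) (left_Dx P - smult [:0, 1:] Q)"
    and "degree_below (Suc n) (left_Dy P - pCons 0 Q)"
proof -
  have "left_Dx P - smult [:0, 1:] Q = left_Dx (P - Q) + map_poly (map_poly der_x) Q"
    using left_add(1)[of "P - Q" Q] by (simp add: left_Dx_def algebra_simps)
  then show "degree_below (Suc n) (left_Dx P - smult [:0, 1:] Q)"
    using degree_below_left(1)[OF PQ] degree_below_map_der(1)[OF Q] by (auto intro: degree_below_add)
  have "left_Dy P - pCons 0 Q = left_Dy (P - Q) + map_poly (map_poly der_y) Q"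
    using left_add(2)[of "P - Q" Q] by (simp add: left_Dy_def algebra_simps)
  then show "degree_below (Suc n) (left_Dy P - pCons 0 Q)"
    using degree_below_left(2)[OF PQ] degree_below_map_der(2)[OF Q] by (auto intro: degree_below_add)
qed

lemma pow_left_approx:
  fixes B :: "'a::diff_field poly poly"
  assumes B: "degree_below (Suc n) B"
  shows "degree_below (i + j + n)
    ((left_Dx ^^ i) ((left_Dy ^^ j) B) - monom (monom 1 i) j * B)"
proof -
  have mB: "degree_below (Suc (i + j + n)) (monom (monom 1 i) j * B)" for i j
    using degree_below_mult[of "i + j" "monom (monom 1 i) j" "Suc n" B] B
    by (simp add: degree_below_def bcoeff_monom)
  show ?thesis
  proof (induction i)
    case 0
    show ?case
    proof (induction j)
      case 0
      then show ?case by (simp add: monom_0 one_pCons[symmetric])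
    next
      case (Suc j)
      have "monom (monom 1 0) (Suc j) * B = pCons 0 (monom (monom 1 0) j * B)"
        by (simp add: monom_Suc)
      then show ?case
        using left_approx_step(2)[OF Suc.IH] mB[of 0 j] by simp
    qed
  next
    case (Suc i)
    have "monom (monom (1::'a) (Suc i)) j = smult [:0, 1:] (monom (monom 1 i) j)"
      by (simp add: smult_monom monom_Suc)
    then have "monom (monom 1 (Suc i)) j * B = smult [:0, 1:] (monom (monom 1 i) j * B)"
      by simp
    then show ?case
      using left_approx_step(1)[OF Suc.IH] mB[of i j] by simp
  qed
qed

text \<open>
  Composition is commutative multiplication up to lower order. Both sides are additive and
  \<open>K\<close>-linear in \<open>A\<close>, which reduces the claim to monomials in \<open>D\<^sub>x\<close> and \<open>D\<^sub>y\<close>.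
\<close>

lemma op_comp_approx:
  fixes A B :: "'a::diff_field poly poly"
  assumes A: "degree_below (Suc m) A" and B: "degree_below (Suc n) B"
  shows "degree_below (m + n) (op_comp A B - A * B)"
proof -
  have "A * B = op_comp A 1 * B"
    by (simp only: op_comp_1_right)
  also have "\<dots> = (\<Sum>j\<le>degree A. \<Sum>i\<le>degree (coeff A j).
      smult [:bcoeff A i j:] (monom (monom 1 i) j * B))"
    by (simp add: op_comp_def pow_left_1 sum_distrib_right)
  finally have "op_comp A B - A * B = (\<Sum>j\<le>degree A. \<Sum>i\<le>degree (coeff A j).
      smult [:bcoeff A i j:] ((left_Dx ^^ i) ((left_Dy ^^ j) B) - monom (monom 1 i) j * B))"
    by (simp add: op_comp_def sum_subtractf smult_diff_right)
  moreover have "degree_below (m + n)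
      (smult [:bcoeff A i j:] ((left_Dx ^^ i) ((left_Dy ^^ j) B) - monom (monom 1 i) j * B))" for i j
  proof (cases "bcoeff A i j = 0")
    case False
    then have "i + j \<le> m" using degree_belowD[OF A] by fastforce
    then show ?thesis
      by (intro degree_below_smult degree_below_mono[OF pow_left_approx[OF B, of i j]]) simp
  qed simp
  ultimately show ?thesis by (simp add: degree_below_sum)
qed

lemma finite_op_orders:
  "finite {i + j | i j. bcoeff (poly_of_lpdo (L :: 'a::diff_field lpdo)) i j \<noteq> 0}"
proof -
  have "{i + j | i j. bcoeff (poly_of_lpdo L) i j \<noteq> 0} =
      (\<lambda>(i, j). i + j) ` {(i, j). op_coeff L i j \<noteq> 0}"
    by (auto simp: op_coeff.rep_eq)
  then show ?thesis using finite_op_support[of L] by simp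
qed

lemma degree_below_op_order: "degree_below (Suc (op_order L)) (poly_of_lpdo L)"
  for L :: "'a::diff_field lpdo"
proof (rule degree_belowI)
  fix i j assume "bcoeff (poly_of_lpdo L) i j \<noteq> 0"
  then have "i + j \<le> op_order L"
    unfolding op_order_def
    by (intro Max_ge) (auto simp: finite_op_orders op_coeff.rep_eq)
  then show "i + j < Suc (op_order L)" by simp
qed

lemma op_order_eqI:
  fixes L :: "'a::diff_field lpdo"
  assumes "degree_below (Suc n) (poly_of_lpdo L)" "bcoeff (poly_of_lpdo L) i j \<noteq> 0" "i + j = n"
  shows "op_order L = n"
  unfolding op_order_def
  using assms degree_belowD[OF assms(1)]
  by (intro Max_eqI) (auto simp: finite_op_orders op_coeff.rep_eq less_Suc_eq_le)

lemma symbol_eq_homogeneous_part: "symbol L = homogeneous_part (op_order L) (poly_of_lpdo L)"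
  by (simp add: symbol_def homogeneous_part_def op_coeff.rep_eq)

lemma bcoeff_symbol:
  "bcoeff (symbol L) i j = (if i + j = op_order L then bcoeff (poly_of_lpdo L) i j else 0)"
  by (simp add: symbol_eq_homogeneous_part bcoeff_homogeneous_part)

lemma symbol_0 [simp]: "symbol 0 = (0 :: 'a::diff_field poly poly)"
  by (rule bcoeff_eqI) (simp add: bcoeff_symbol zero_lpdo.rep_eq)

lemma symbol_approx: "degree_below (op_order L) (poly_of_lpdo L - symbol L)"
  for L :: "'a::diff_field lpdo"
proof (rule degree_belowI)
  fix i j assume "bcoeff (poly_of_lpdo L - symbol L) i j \<noteq> 0"
  then have "bcoeff (poly_of_lpdo L) i j \<noteq> 0" "i + j \<noteq> op_order L"
    by (auto simp: bcoeff_diff bcoeff_symbol split: if_splits)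
  with degree_belowD[OF degree_below_op_order[of L], of i j]
  show "i + j < op_order L" by simp
qed

lemma symbol_homogeneous:
  fixes L :: "'a::diff_field lpdo"
  assumes "L \<noteq> 0"
  shows "homogeneous_of_degree (op_order L) (symbol L)"
proof -
  have "symbol L \<noteq> 0"
  proof
    assume "symbol L = 0"
    with symbol_approx[of L] have *: "degree_below (op_order L) (poly_of_lpdo L)" by simp
    have ne: "poly_of_lpdo L \<noteq> 0" using assms by transfer
    then obtain i j where ij: "bcoeff (poly_of_lpdo L) i j \<noteq> 0"
      by (metis bcoeff_0 bcoeff_eqI)
    have "op_order L \<in> insert 0 {i + j | i j. op_coeff L i j \<noteq> 0}"
      unfolding op_order_def by (rule Max_in) (auto simp: finite_op_orders op_coeff.rep_eq)
    moreover have "op_order L \<noteq> 0" using degree_belowD[OF * ij] by simp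
    ultimately obtain k l where "op_order L = k + l" "bcoeff (poly_of_lpdo L) k l \<noteq> 0"
      by (auto simp: op_coeff.rep_eq)
    with degree_belowD[OF *] show False by fastforce
  qed
  then show ?thesis
    by (auto simp: homogeneous_of_degree_def bcoeff_symbol split: if_splits)
qed

text \<open>
  The working characterization of the symbol: the only homogeneous polynomial that agrees with
  the operator up to lower order.
\<close>

lemma symbol_eqI:
  fixes L :: "'a::diff_field lpdo"
  assumes W: "homogeneous_of_degree n W" and LW: "degree_below n (poly_of_lpdo L - W)"
  shows "symbol L = W" and "op_order L = n"
proof -
  have "poly_of_lpdo L = (poly_of_lpdo L - W) + W" by simp
  then have below: "degree_below (Suc n) (poly_of_lpdo L)"
    using degree_below_add[OF degree_below_mono[OF LW] homogeneous_imp_degree_below[OF W]] by simp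
  have top: "bcoeff (poly_of_lpdo L) i j = bcoeff W i j" if "i + j = n" for i j
    using degree_belowD[OF LW, of i j] that by (auto simp: bcoeff_diff)
  from W obtain i j where ij: "bcoeff W i j \<noteq> 0" "i + j = n"
    unfolding homogeneous_of_degree_def by (metis bcoeff_0 bcoeff_eqI)
  then show ord: "op_order L = n"
    using op_order_eqI[OF below] top by metis
  show "symbol L = W"
    using W by (intro bcoeff_eqI) (auto simp: bcoeff_symbol ord top homogeneous_of_degree_def)
qed

lemma symbol_mult: "symbol (A * B) = symbol A * symbol B"
  for A B :: "'a::diff_field lpdo"
proof (cases "A = 0 \<or> B = 0")
  case False
  let ?A = "poly_of_lpdo A" and ?B = "poly_of_lpdo B"
  let ?m = "op_order A" and ?n = "op_order B"
  have hA: "homogeneous_of_degree ?m (symbol A)" and hB: "homogeneous_of_degree ?n (symbol B)"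
    using False by (auto intro: symbol_homogeneous)
  have "degree_below (?m + ?n) (op_comp ?A ?B - ?A * ?B)"
    by (intro op_comp_approx degree_below_op_order)
  moreover have "degree_below (?m + ?n) (?B * (?A - symbol A))"
    using degree_below_mult[OF degree_below_op_order symbol_approx, of B A] by (simp add: add.commute)
  moreover have "degree_below (?m + ?n) (symbol A * (?B - symbol B))"
    by (intro degree_below_mult homogeneous_imp_degree_below hA symbol_approx)
  moreover have "op_comp ?A ?B - symbol A * symbol B =
      (op_comp ?A ?B - ?A * ?B) + (?B * (?A - symbol A) + symbol A * (?B - symbol B))"
    by (simp add: algebra_simps)
  ultimately have "degree_below (?m + ?n) (poly_of_lpdo (A * B) - symbol A * symbol B)"
    by (simp only: times_lpdo.rep_eq degree_below_add)
  with homogeneous_of_degree_mult[OF hA hB] show ?thesis by (rule symbol_eqI)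
qed auto


section \<open>Factors with coprime symbols\<close>

text \<open>
  The key step: left multiplication by \<open>F\<^sub>1\<close> is injective modulo the left ideal generated by
  \<open>F\<^sub>2\<close>, because this already holds for the symbols.
\<close>

lemma right_factor_cancel:
  fixes F\<^sub>1 F\<^sub>2 G H :: "'a::diff_field lpdo"
  assumes prime: "prime_elem (symbol F\<^sub>2)" and ndvd: "\<not> symbol F\<^sub>2 dvd symbol F\<^sub>1"
    and "F\<^sub>1 * G = H * F\<^sub>2"
  shows "is_right_factor F\<^sub>2 G"
proof -
  \<comment> \<open>The induction is on a bound, since the order cannot tell zero from nonzero constants.\<close>
  have "is_right_factor F\<^sub>2 G" if "degree_below k (poly_of_lpdo G)" "F\<^sub>1 * G = H * F\<^sub>2" for k G H
    using that
  proof (induction k arbitrary: G H)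
    case 0
    then have "poly_of_lpdo G = 0" by (simp add: degree_below_0_iff)
    then have "G = 0 * F\<^sub>2" by (simp add: poly_of_lpdo_inject[symmetric] zero_lpdo.rep_eq)
    then show ?case unfolding is_right_factor_def by blast
  next
    case (Suc k)
    show ?case
    proof (cases "G = 0")
      case True
      then have "G = 0 * F\<^sub>2" by simp
      then show ?thesis unfolding is_right_factor_def by blast
    next
      case False
      let ?n = "op_order G"
      have hG: "homogeneous_of_degree ?n (symbol G)" by (rule symbol_homogeneous[OF False])
      have "F\<^sub>2 \<noteq> 0" using prime by auto
      then have hF: "homogeneous_of_degree (op_order F\<^sub>2) (symbol F\<^sub>2)" by (rule symbol_homogeneous)
      have "symbol F\<^sub>1 * symbol G = symbol H * symbol F\<^sub>2"
        using Suc.prems(2) by (metis symbol_mult)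
      then have "symbol F\<^sub>2 dvd symbol F\<^sub>1 * symbol G" by simp
      with prime ndvd have "symbol F\<^sub>2 dvd symbol G"
        by (auto simp: prime_elem_dvd_mult_iff)
      then obtain W where W: "symbol G = symbol F\<^sub>2 * W" by (rule dvdE)
      have le: "op_order F\<^sub>2 \<le> ?n" and hW: "homogeneous_of_degree (?n - op_order F\<^sub>2) W"
        using homogeneous_factor[OF hF] hG W by auto
      \<comment> \<open>Any operator with symbol \<open>W\<close> would do; this one is \<open>W\<close> with \<open>D\<^sub>x, D\<^sub>y\<close> put for \<open>X, Y\<close>.\<close>
      define Q where "Q = Lpdo W"
      have "degree_below (?n - op_order F\<^sub>2) (poly_of_lpdo Q - W)"
        by (simp add: Q_def Lpdo_inverse)
      note Q = symbol_eqI[OF hW this]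
      have sQ: "symbol (Q * F\<^sub>2) = symbol G"
        by (simp add: symbol_mult Q W)
      then have "Q * F\<^sub>2 \<noteq> 0" using hG by (auto simp: homogeneous_of_degree_def)
      from symbol_homogeneous[OF this] have oQ: "op_order (Q * F\<^sub>2) = ?n"
        unfolding sQ using hG by (rule homogeneous_of_degree_unique)
      have "poly_of_lpdo (G - Q * F\<^sub>2) =
          (poly_of_lpdo G - symbol G) - (poly_of_lpdo (Q * F\<^sub>2) - symbol (Q * F\<^sub>2))"
        by (simp add: sQ minus_lpdo.rep_eq)
      then have "degree_below ?n (poly_of_lpdo (G - Q * F\<^sub>2))"
        using degree_below_diff[OF symbol_approx[of G] symbol_approx[of "Q * F\<^sub>2", unfolded oQ]]
        by simp
      moreover have "?n \<le> k"
      proof -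
        from hG obtain i j where "bcoeff (symbol G) i j \<noteq> 0"
          unfolding homogeneous_of_degree_def by (metis bcoeff_0 bcoeff_eqI)
        then have "i + j = ?n" "bcoeff (poly_of_lpdo G) i j \<noteq> 0"
          by (auto simp: bcoeff_symbol split: if_splits)
        with degree_belowD[OF Suc.prems(1)] show ?thesis by fastforce
      qed
      ultimately have "degree_below k (poly_of_lpdo (G - Q * F\<^sub>2))" by (rule degree_below_mono)
      moreover have "F\<^sub>1 * (G - Q * F\<^sub>2) = (H - F\<^sub>1 * Q) * F\<^sub>2"
        using Suc.prems(2) by (simp add: algebra_simps)
      ultimately have "is_right_factor F\<^sub>2 (G - Q * F\<^sub>2)" by (rule Suc.IH)
      then obtain R where "G - Q * F\<^sub>2 = R * F\<^sub>2" unfolding is_right_factor_def by blast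
      then have "G = (R + Q) * F\<^sub>2" by (simp add: algebra_simps)
      then show ?thesis unfolding is_right_factor_def by blast
    qed
  qed
  then show ?thesis using degree_below_op_order assms(3) by blast
qed

lemma op_order_eq_if_symbol_homogeneous:
  fixes L :: "'a::diff_field lpdo"
  assumes "homogeneous_of_degree n (symbol L)"
  shows "op_order L = n"
proof -
  have "L \<noteq> 0" using assms by (auto simp: homogeneous_of_degree_def)
  then show ?thesis using symbol_homogeneous assms homogeneous_of_degree_unique by blast
qed

theorem theorem4:
  fixes S1 S2 :: "'a::diff_closed_field poly poly"
    and L :: "'a lpdo"
  assumes "homogeneous_of_degree 1 S1" and "homogeneous_of_degree 1 S2"
    and "coprime S1 S2"
    and "op_order L = 3"
  shows "((\<exists>F. op_order F = 1 \<and> symbol F = S1 \<and> is_left_factor F L) \<and>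
          (\<exists>F. op_order F = 1 \<and> symbol F = S2 \<and> is_right_factor F L)) \<longleftrightarrow>
         has_factorization_of_type L [S1, symbol L div (S1 * S2), S2]"
    (is "?left_right \<longleftrightarrow> ?type")
proof
  assume ?left_right
  then obtain F\<^sub>1 F\<^sub>2 G H where F: "symbol F\<^sub>1 = S1" "symbol F\<^sub>2 = S2"
    and L1: "L = F\<^sub>1 * G" and L2: "L = H * F\<^sub>2"
    unfolding is_left_factor_def is_right_factor_def by blast
  have prime: "prime_elem S2"
    using assms(2) by (rule prime_elem_linear_form)
  then have "\<not> S2 dvd S1"
    using assms(3) by (meson coprime_common_divisor dvd_refl prime_elem_def)
  with prime L1 L2 have "is_right_factor F\<^sub>2 G"
    by (intro right_factor_cancel[of F\<^sub>2 F\<^sub>1 G H]) (simp_all add: F)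
  then obtain Q where L: "L = F\<^sub>1 * (Q * F\<^sub>2)"
    using L1 unfolding is_right_factor_def by blast
  then have sL: "symbol L = S1 * S2 * symbol Q"
    by (simp add: symbol_mult F mult_ac)
  moreover have "S1 * S2 \<noteq> 0" using assms(1,2) by (simp add: homogeneous_of_degree_def)
  ultimately have sQ: "symbol L div (S1 * S2) = symbol Q" by simp
  have "L = prod_list [F\<^sub>1, Q, F\<^sub>2]" using L by simp
  moreover have "map symbol [F\<^sub>1, Q, F\<^sub>2] = [S1, symbol L div (S1 * S2), S2]" by (simp add: F sQ)
  moreover have "symbol L = prod_list [S1, symbol L div (S1 * S2), S2]"
    unfolding sQ by (simp add: sL mult_ac)
  ultimately show ?type
    unfolding has_factorization_of_type_def by (intro conjI exI[of _ "[F\<^sub>1, Q, F\<^sub>2]"])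
next
  assume ?type
  then obtain Fs where L': "L = prod_list Fs"
    and Ss: "map symbol Fs = [S1, symbol L div (S1 * S2), S2]"
    unfolding has_factorization_of_type_def by (elim conjE exE) (rule that)
  from Ss obtain F\<^sub>1 Q F\<^sub>2 where Fs: "Fs = [F\<^sub>1, Q, F\<^sub>2]"
    and F: "symbol F\<^sub>1 = S1" "symbol F\<^sub>2 = S2"
    by (auto simp only: map_eq_Cons_conv list.map_disc_iff)
  from L' Fs have L: "L = F\<^sub>1 * (Q * F\<^sub>2)" by simp
  have "is_left_factor F\<^sub>1 L" unfolding is_left_factor_def L by blast
  moreover have "is_right_factor F\<^sub>2 L"
    unfolding is_right_factor_def L by (metis mult.assoc)
  moreover have "op_order F\<^sub>1 = 1" "op_order F\<^sub>2 = 1"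
    using assms(1,2) F op_order_eq_if_symbol_homogeneous by blast+
  ultimately show ?left_right using F by blast
qed

end
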